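(* Let $\alpha>2$. For $\lambda_{\rm p}>0$, $\delta>0$ and $0\le r_0\le\delta$, let $\mathrm{EIR}$ denote the excess interference ratio of the Matérn hard-core process of type I with parent intensity $\lambda_{\rm p}$ and hard-core distance $\delta$, for the power path loss law $g(r)=(\max\{r_0,r\})^{-\alpha}$. Then $$\mathrm{EIR}=\Omega\big(e^{\lambda_{\rm p}\delta^2}\big)\qquad\text{as }\lambda_{\rm p}\delta\to\infty,$$ i.e., there exist constants $c>0$ and $M>0$ (depending only on $\alpha$) such that $\mathrm{EIR}\ge c\,e^{\lambda_{\rm p}\delta^2}$ for all $\lambda_{\rm p},\delta>0$ with $\lambda_{\rm p}\delta\ge M$ and all $0\le r_0\le\delta$.
   Context: **Matérn process of type I.** Start from a stationary Poisson point process (PPP) on $\mathbb{R}^2$ of intensity $\lambda_{\rm p}$ (the parent process) and retain a point if and only if it is at distance at least $\delta$ from all other points of the parent process. The resulting stationary, isotropic process $\Phi$ has intensity $\lambda=\lambda_{\rm p}\exp(-\lambda_{\rm p}\pi\delta^2)$. **Mean interference.** For a stationary point process $\Phi\subset\mathbb{R}^2$ of intensity $\lambda$ and a radially symmetric path loss function $g(x)=g(\|x\|)\ge 0$, the interference at the origin $o$ is $I=\sum_{x\in\Phi}h_x g(x)$, where the $h_x$ are nonnegative fading coefficients, independent of $\Phi$, with $\mathbb{E}(h_x)=1$. $\mathbb{E}_o^!(I)$ denotes the expectation of $I$ with respect to the reduced Palm distribution of $\Phi$ at $o$ (i.e., given that $o\in\Phi$, but not counting the contribution of $o$). With $\mathcal{K}$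 the reduced second moment measure, so that $\mathcal{K}(B)$ is the mean number of points in $B$ under the reduced Palm distribution at $o$, and $K(r)=\frac1\lambda\mathcal{K}(b_o(r))$, where $b_o(r)$ is the ball of radius $r$ centered at $o$, for isotropic $\Phi$ one has $$\mathbb{E}_o^!(I)=\int_{\mathbb{R}^2}g(x)\,\mathcal{K}(\mathrm{d}x)=\lambda\int_0^\infty g(r)K'(r)\,\mathrm{d}r .$$ For the type I process, $K(r)=2\pi\exp(2\lambda_{\rm p}\pi\delta^2)\int_0^r u\,k(u)\,\mathrm{d}u$, where $k(u)=0$ for $u<\delta$ and $k(u)=\exp(-\lambda_{\rm p}V_\delta(u))$ for $u\ge\delta$. Here $V_\delta(u)$ is the area of the union of two disks of radius $\delta$ whose centers are at distance $u$: $V_\delta(u)=2\pi\delta^2-2\delta^2\arccos\left(\frac{u}{2\delta}\right)+u\sqrt{\delta^2-\frac{u^2}{4}}$ for $0\le u\le 2\delta$, and $V_\delta(u)=2\pi\delta^2$ for $u>2\delta$. Hence $$\mathbb{E}_o^!(I)=2\pi\lambda_{\rm p}\exp(\pi\lambda_{\rm p}\delta^2)\int_\delta^\infty g(r)\,r\exp(-\lambda_{\rm p}V_\delta(r))\,\mathrm{d}r .$$ **Excess interference ratio (EIR).** For a stationary hard-core point process of intensity $\lambda$ with minimum distance $\delta$, $\mathrm{EIR}=\mathbb{E}_o^!(I)/\mathbb{E}_o^!(I_{\rm PPP})$, where $\mathbb{E}_o^!(I_{\rm PPP})=2\pi\lambda\int_\delta^\infty g(r)\,r\,\mathrm{d}r$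 is the mean interference at $o$ in a Poisson process with intensity function $\lambda\mathbf{1}_{[\delta,\infty)}(r)$, $r=\|x\|$, with the same $\lambda$ (the intensity of the hard-core process, not of its parent). *)

theory Defs
  imports "HOL-Probability.Probability"
begin

text \<open>
  A (simple) point process on the plane is a random locally finite set \<open>\<Psi>\<close>, defined on a
  probability space \<open>P\<close>. The Poisson probabilities are written out because
  \<^const>\<open>poisson_pmf\<close> presupposes a positive rate, whereas null sets \<open>B\<close> have rate 0.
\<close>

definition stationary_ppp :: "real \<Rightarrow> 'w measure \<Rightarrow> ('w \<Rightarrow> (real ^ 2) set) \<Rightarrow> bool" where
  "stationary_ppp \<rho> P \<Psi> \<longleftrightarrow>
     prob_space P \<and>
     (\<forall>\<omega>\<in>space P. \<forall>B. bounded B \<longrightarrow> finite (\<Psi> \<omega> \<inter> B)) \<and>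
     (\<forall>B. B \<in> sets borel \<and> bounded B \<longrightarrow>
        (\<lambda>\<omega>. card (\<Psi> \<omega> \<inter> B)) \<in> P \<rightarrow>\<^sub>M count_space UNIV \<and>
        (\<forall>k. measure P {\<omega> \<in> space P. card (\<Psi> \<omega> \<inter> B) = k} =
              (\<rho> * measure lborel B) ^ k / fact k * exp (- (\<rho> * measure lborel B)))) \<and>
     (\<forall>(B :: nat \<Rightarrow> (real ^ 2) set) n.
        (\<forall>i<n. B i \<in> sets borel \<and> bounded (B i)) \<and> disjoint_family_on B {..<n} \<longrightarrow>
        prob_space.indep_vars P (\<lambda>_. count_space UNIV) (\<lambda>i \<omega>. card (\<Psi> \<omega> \<inter> B i)) {..<n})"

definition matern_I :: "real \<Rightarrow> (real ^ 2) set \<Rightarrow> (real ^ 2) set" where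
  "matern_I \<delta> \<phi> = {x \<in> \<phi>. \<forall>y\<in>\<phi>. y \<noteq> x \<longrightarrow> \<delta> \<le> dist x y}"

text \<open>
  Intensity and reduced Palm expectation of a stationary point process \<open>\<Phi>\<close>. Both are normalised
  by the unit square \<open>cbox 0 One\<close>; by stationarity any other Borel set of area 1 gives the
  same values. The reduced Palm expectation is the one of Campbell's formula: for
  \<open>F \<ge> 0\<close>, the expectation of \<open>F\<close> under the reduced Palm distribution at the origin is
  \<open>1 / intensity P \<Phi>\<close> times the expectation of the sum, over the points \<open>x\<close> of \<open>\<Phi>\<close> in the unit square, of
  \<open>F\<close> evaluated at the configuration \<open>\<Phi>\<close> without \<open>x\<close>, translated so that \<open>x\<close> becomes the
  origin. Integrals with respect to \<open>count_space\<close> are sums of nonnegative terms.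
\<close>

definition intensity :: "'w measure \<Rightarrow> ('w \<Rightarrow> (real ^ 2) set) \<Rightarrow> ennreal" where
  "intensity P \<Phi> = (\<integral>\<^sup>+\<omega>. emeasure (count_space UNIV) (\<Phi> \<omega> \<inter> cbox 0 One) \<partial>P)"

definition reduced_palm_expectation ::
    "'w measure \<Rightarrow> ('w \<Rightarrow> (real ^ 2) set) \<Rightarrow> ((real ^ 2) set \<Rightarrow> ennreal) \<Rightarrow> ennreal" where
  "reduced_palm_expectation P \<Phi> F =
     (\<integral>\<^sup>+\<omega>. (\<integral>\<^sup>+x. F ((\<lambda>y. y - x) ` (\<Phi> \<omega> - {x})) \<partial>count_space (\<Phi> \<omega> \<inter> cbox 0 One)) \<partial>P)
       / intensity P \<Phi>"

definition interference :: "(real ^ 2 \<Rightarrow> real) \<Rightarrow> (real \<Rightarrow> real) \<Rightarrow> (real ^ 2) set \<Rightarrow> ennreal" where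
  "interference h g \<phi> = (\<integral>\<^sup>+x. ennreal (h x * g (norm x)) \<partial>count_space \<phi>)"

definition fading :: "'h measure \<Rightarrow> (real ^ 2 \<Rightarrow> 'h \<Rightarrow> real) \<Rightarrow> bool" where
  "fading H h \<longleftrightarrow>
     prob_space H \<and>
     (\<forall>x. h x \<in> borel_measurable H \<and> (\<forall>\<eta>\<in>space H. 0 \<le> h x \<eta>) \<and> integral\<^sup>L H (h x) = 1)"

text \<open>
  The fading coefficients live on a probability space \<open>H\<close> of their own. Their independence of
  the point process is expressed by averaging over \<open>H\<close> with the configuration held fixed, i.e. by
  integrating over the product of the two spaces.
\<close>

definition palm_mean_interference ::
    "'w measure \<Rightarrow> ('w \<Rightarrow> (real ^ 2) set) \<Rightarrow> 'h measure \<Rightarrow> (real ^ 2 \<Rightarrow> 'h \<Rightarrow> real)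
      \<Rightarrow> (real \<Rightarrow> real) \<Rightarrow> ennreal" where
  "palm_mean_interference P \<Phi> H h g =
     reduced_palm_expectation P \<Phi> (\<lambda>\<phi>. \<integral>\<^sup>+\<eta>. interference (\<lambda>x. h x \<eta>) g \<phi> \<partial>H)"

text \<open>
  Mean interference at the origin in a Poisson process with intensity function
  \<open>x \<mapsto> \<rho> * indicator {\<delta>..} (norm x)\<close>, in polar coordinates.
\<close>

definition ppp_mean_interference :: "ennreal \<Rightarrow> real \<Rightarrow> (real \<Rightarrow> real) \<Rightarrow> ennreal" where
  "ppp_mean_interference \<rho> \<delta> g =
     ennreal (2 * pi) * \<rho> * (\<integral>\<^sup>+r\<in>{\<delta>..}. ennreal (g r * r) \<partial>lborel)"

definition EIR ::
    "'w measure \<Rightarrow> ('w \<Rightarrow> (real ^ 2) set) \<Rightarrow> real \<Rightarrow> 'h measure \<Rightarrow> (real ^ 2 \<Rightarrow> 'h \<Rightarrow> real)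
      \<Rightarrow> (real \<Rightarrow> real) \<Rightarrow> ennreal" where
  "EIR P \<Phi> \<delta> H h g =
     palm_mean_interference P \<Phi> H h g / ppp_mean_interference (intensity P \<Phi>) \<delta> g"

definition power_path_loss :: "real \<Rightarrow> real \<Rightarrow> real \<Rightarrow> real" where
  "power_path_loss \<alpha> r0 r = (max r0 r) powr (- \<alpha>)"

end

theory Submission
  imports Defs
begin

text \<open>
  Let \<open>t = \<delta> / 500\<close> and cut the unit square into cells of side at most \<open>t\<close>. A cell containing a point of
  the type I process contains exactly one parent point and sits in a disk of radius \<open>\<delta> - 2 * t\<close> free of other
  parent points, so the intensity is at most \<open>\<rho> * exp (- \<rho> * pi * (\<delta> - 2 * t)\<^sup>2)\<close>. Conversely, put a square of
  side \<open>t\<close> at distance \<open>r = \<delta> + 2 * t\<close> from each cell: if both contain exactly one parent point and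
  the two disks of radius \<open>r\<close> around their corners contain no other, then both points are retained, and they are at
  distance between \<open>\<delta>\<close> and \<open>2 * \<delta>\<close>. The area of the union of the disks is at most
  \<open>(2 * pi - 1.12) * r\<^sup>2\<close>, which bounds the mean interference from below. In the ratio the contributions
  \<open>2 * pi\<close> in the exponent cancel up to the discretisation error, and the area 1.12 of the lens leaves
  \<open>exp (\<rho> * \<delta>\<^sup>2)\<close>. Only bounds by finitely many independent cell counts are needed, so the measurability of
  the type I process never matters.
\<close>

section \<open>Events described by finitely many Poisson counts\<close>

lemma stationary_ppp_finite:
  assumes "stationary_ppp \<rho> P \<Psi>" "\<omega> \<in> space P" "bounded B"
  shows "finite (\<Psi> \<omega> \<inter> B)"
  using assms unfolding stationary_ppp_def by blast

lemma stationary_ppp_count_event: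
  assumes "stationary_ppp \<rho> P \<Psi>" "B \<in> sets borel" "bounded B"
  shows "{\<omega> \<in> space P. card (\<Psi> \<omega> \<inter> B) = k} \<in> sets P"
proof -
  have "(\<lambda>\<omega>. card (\<Psi> \<omega> \<inter> B)) \<in> P \<rightarrow>\<^sub>M count_space UNIV"
    using assms unfolding stationary_ppp_def by blast
  from measurable_sets[OF this, of "{k}"] show ?thesis
    by (auto simp: vimage_def Int_def conj_commute)
qed

lemma stationary_ppp_count_prob:
  assumes "stationary_ppp \<rho> P \<Psi>" "B \<in> sets borel" "bounded B"
  shows "measure P {\<omega> \<in> space P. card (\<Psi> \<omega> \<inter> B) = k} =
    (\<rho> * measure lborel B) ^ k / fact k * exp (- (\<rho> * measure lborel B))"
  using assms(1)[unfolded stationary_ppp_def, THEN conjunct2, THEN conjunct2, THEN conjunct1] assms(2,3)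
  by simp

lemma stationary_ppp_joint_counts:
  fixes n :: nat
  assumes ppp: "stationary_ppp \<rho> P \<Psi>" and n: "0 < n"
    and B: "\<And>i. i < n \<Longrightarrow> B i \<in> sets borel" "\<And>i. i < n \<Longrightarrow> bounded (B i)"
    and disj: "disjoint_family_on B {..<n}"
  shows "{\<omega> \<in> space P. \<forall>i<n. card (\<Psi> \<omega> \<inter> B i) = k i} \<in> sets P" (is "?E \<in> _")
    and "measure P {\<omega> \<in> space P. \<forall>i<n. card (\<Psi> \<omega> \<inter> B i) = k i} =
      (\<Prod>i<n. (\<rho> * measure lborel (B i)) ^ k i / fact (k i) * exp (- (\<rho> * measure lborel (B i))))"
proof -
  interpret prob_space P
    using ppp unfolding stationary_ppp_def by blast
  have ind: "indep_vars (\<lambda>_. count_space UNIV) (\<lambda>i \<omega>. card (\<Psi> \<omega> \<inter> B i)) {..<n}"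
    using ppp[unfolded stationary_ppp_def, THEN conjunct2, THEN conjunct2, THEN conjunct2,
        THEN spec[of _ B], THEN spec[of _ n]] B disj
    by simp
  have E: "?E = (\<Inter>i\<in>{..<n}. (\<lambda>\<omega>. card (\<Psi> \<omega> \<inter> B i)) -` {k i} \<inter> space P)"
    using n by auto
  have vim: "(\<lambda>\<omega>. card (\<Psi> \<omega> \<inter> B i)) -` {k i} \<inter> space P =
      {\<omega> \<in> space P. card (\<Psi> \<omega> \<inter> B i) = k i}" for i
    by auto
  show "?E \<in> sets P"
    unfolding E vim using n B by (intro sets.finite_INT stationary_ppp_count_event[OF ppp]) auto
  have "prob ?E = (\<Prod>i<n. prob ((\<lambda>\<omega>. card (\<Psi> \<omega> \<inter> B i)) -` {k i} \<inter> space P))"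
    unfolding E using n by (intro indep_varsD_finite[OF ind]) auto
  also have "\<dots> = (\<Prod>i<n. (\<rho> * measure lborel (B i)) ^ k i / fact (k i) * exp (- (\<rho> * measure lborel (B i))))"
    unfolding vim using B by (intro prod.cong refl stationary_ppp_count_prob[OF ppp]) auto
  finally show "prob ?E = \<dots>" .
qed

lemma lborel_finite_bounded:
  "B \<in> sets borel \<Longrightarrow> bounded B \<Longrightarrow> emeasure lborel B \<noteq> \<infinity>"
  using emeasure_bounded_finite[of B] by (auto simp: less_top)

text \<open>For disjoint cells \<open>S i\<close> inside \<open>U\<close> this prescribes counts on
  disjoint sets: one in each cell, zero in the rest of \<open>U\<close>. A single cell serves the
  intensity, two cells serve pairs of retained points.\<close>

definition isolated_config ::
    "nat \<Rightarrow> (nat \<Rightarrow> (real ^ 2) set) \<Rightarrow> (real ^ 2) set \<Rightarrow> (real ^ 2) set \<Rightarrow> bool" where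
  "isolated_config n S U \<phi> \<longleftrightarrow>
     (\<forall>i<n. is_singleton (\<phi> \<inter> S i)) \<and> \<phi> \<inter> U \<subseteq> (\<Union>i<n. S i)"

text \<open>The exponential factors of the cells and of the empty remainder multiply to one factor,
  in which only the area of \<open>U\<close> appears.\<close>

lemma stationary_ppp_isolated_config:
  assumes ppp: "stationary_ppp \<rho> P \<Psi>"
    and S: "\<And>i. i < n \<Longrightarrow> S i \<in> sets borel" "\<And>i. i < n \<Longrightarrow> S i \<subseteq> U"
    and disj: "disjoint_family_on S {..<n}"
    and U: "U \<in> sets borel" "bounded U"
  shows "{\<omega> \<in> space P. isolated_config n S U (\<Psi> \<omega>)} \<in> sets P" (is "?E \<in> _")
    and "measure P {\<omega> \<in> space P. isolated_config n S U (\<Psi> \<omega>)} =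
      (\<Prod>i<n. \<rho> * measure lborel (S i)) * exp (- (\<rho> * measure lborel U))"
proof -
  \<comment> \<open>The remainder of \<open>U\<close> joins the family as the set with index
    \<open>n\<close> and prescribed count 0.\<close>
  define V where "V = U - (\<Union>i<n. S i)"
  define B where "B i = (if i < n then S i else V)" for i
  define k :: "nat \<Rightarrow> nat" where "k i = (if i < n then 1 else 0)" for i
  have bS: "bounded (S i)" if "i < n" for i
    using S(2)[OF that] U(2) bounded_subset by blast
  have V: "V \<in> sets borel" "bounded V"
    unfolding V_def using S U by (auto intro: bounded_subset)
  have B: "B i \<in> sets borel" "bounded (B i)" for i
    using S bS V by (auto simp: B_def)
  have dB: "disjoint_family_on B {..<Suc n}"
    using disj by (force simp: disjoint_family_on_def B_def V_def)
  have E: "?E = {\<omega> \<in> space P. \<forall>i<Suc n. card (\<Psi> \<omega> \<inter> B i) = k i}"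
  proof (rule Collect_cong, rule conj_cong[OF refl])
    fix \<omega> assume "\<omega> \<in> space P"
    \<comment> \<open>Local finiteness matters: \<open>card\<close> of an infinite set is also 0, so
      a zero count alone would not mean emptiness.\<close>
    then have "card (\<Psi> \<omega> \<inter> V) = 0 \<longleftrightarrow> \<Psi> \<omega> \<inter> V = {}"
      using stationary_ppp_finite[OF ppp _ V(2)] by simp
    also have "\<dots> \<longleftrightarrow> \<Psi> \<omega> \<inter> U \<subseteq> (\<Union>i<n. S i)"
      by (auto simp: V_def)
    finally show "isolated_config n S U (\<Psi> \<omega>) \<longleftrightarrow> (\<forall>i<Suc n. card (\<Psi> \<omega> \<inter> B i) = k i)"
      by (auto simp: isolated_config_def is_singleton_altdef B_def k_def less_Suc_eq)
  qed
  show "?E \<in> sets P"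
    unfolding E by (rule stationary_ppp_joint_counts(1)[OF ppp _ B dB]) simp
  have "(\<Union>i\<in>{..<Suc n}. B i) = U"
    using S(2) by (auto simp: B_def V_def less_Suc_eq)
  then have U_eq: "measure lborel U = (\<Sum>i<Suc n. measure lborel (B i))"
    using measure_finite_Union[of "{..<Suc n}" B lborel] B dB lborel_finite_bounded by auto
  have "measure P ?E = (\<Prod>i<Suc n. (\<rho> * measure lborel (B i)) ^ k i / fact (k i) * exp (- (\<rho> * measure lborel (B i))))"
    unfolding E by (rule stationary_ppp_joint_counts(2)[OF ppp _ B dB]) simp
  also have "\<dots> = (\<Prod>i<Suc n. (\<rho> * measure lborel (B i)) ^ k i / fact (k i)) * exp (- (\<rho> * measure lborel U))"
    by (simp only: prod.distrib U_eq sum_distrib_left sum_negf[symmetric] exp_sum finite_lessThan)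
  also have "(\<Prod>i<Suc n. (\<rho> * measure lborel (B i)) ^ k i / fact (k i)) = (\<Prod>i<n. \<rho> * measure lborel (S i))"
    by (simp add: B_def k_def)
  finally show "measure P ?E = (\<Prod>i<n. \<rho> * measure lborel (S i)) * exp (- (\<rho> * measure lborel U))" .
qed

section \<open>Squares, disks and lenses in the plane\<close>

lemma norm_le_abs_sum_2: "norm (v :: real ^ 2) \<le> \<bar>v $ 1\<bar> + \<bar>v $ 2\<bar>"
  using norm_le_l1_cart[of v] by (simp add: sum_2)

lemma norm_2_squared: "(norm (v :: real ^ 2))\<^sup>2 = (v $ 1)\<^sup>2 + (v $ 2)\<^sup>2"
  by (simp add: norm_vec_def L2_set_def sum_2)

lemma content_rectangle:
  assumes "a $ 1 \<le> b $ 1" "a $ 2 \<le> b $ 2"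
  shows "measure lborel (cbox a b) = (b $ 1 - a $ 1) * (b $ 2 - a $ 2 :: real)"
    and "measure lborel (box a (b :: real ^ 2)) = (b $ 1 - a $ 1) * (b $ 2 - a $ 2)"
proof -
  have "cbox a b \<noteq> {}"
    using assms by (auto simp: interval_ne_empty_cart forall_2)
  then show "measure lborel (cbox a b) = (b $ 1 - a $ 1) * (b $ 2 - a $ 2)"
    by (simp add: content_cbox_cart UNIV_2)
  then show "measure lborel (box a b) = (b $ 1 - a $ 1) * (b $ 2 - a $ 2)"
    by (simp add: measure_def emeasure_lborel_box_eq emeasure_lborel_cbox_eq)
qed

lemma mem_square:
  fixes x p :: "real ^ 2"
  shows "x \<in> cbox p (p + vec s) \<longleftrightarrow> p $ 1 \<le> x $ 1 \<and> x $ 1 \<le> p $ 1 + s \<and> p $ 2 \<le> x $ 2 \<and> x $ 2 \<le> p $ 2 + s"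
    and "x \<in> box p (p + vec s) \<longleftrightarrow> p $ 1 < x $ 1 \<and> x $ 1 < p $ 1 + s \<and> p $ 2 < x $ 2 \<and> x $ 2 < p $ 2 + s"
  by (auto simp: mem_box_cart forall_2)

lemma mem_unit_square:
  "x \<in> cbox 0 (One :: real ^ 2) \<longleftrightarrow> 0 \<le> x $ 1 \<and> x $ 1 \<le> 1 \<and> 0 \<le> x $ 2 \<and> x $ 2 \<le> 1"
proof -
  have "(One :: real ^ 2) $ i = 1" for i
    using inner_sum_left_Basis[of "axis i 1 :: real ^ 2" "\<lambda>_. 1"] by (simp add: inner_axis axis_in_Basis_iff)
  then show ?thesis by (auto simp: mem_box_cart forall_2)
qed

text \<open>The 1-norm gives the crude \<open>2 * s\<close> in place of \<open>sqrt 2 * s\<close>.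
  This is the source of the margins \<open>2 * s\<close> and \<open>2 * t\<close> in the radii
  below.\<close>

lemma dist_square_corner:
  fixes x p :: "real ^ 2"
  assumes "x \<in> cbox p (p + vec s)"
  shows "dist x p \<le> 2 * s"
  using norm_le_abs_sum_2[of "x - p"] assms by (auto simp: dist_norm mem_square)

text \<open>
  The lens contains the region \<open>\<bar>x - r / 2\<bar> \<le> r / 2 - 2 * y\<^sup>2 / (3 * r)\<close> between two
  parabolas (coordinates relative to \<open>c\<close>), whose area is \<open>2 * r\<^sup>2 / sqrt 3\<close>, about \<open>1.155 * r\<^sup>2\<close>.
  It is exhausted by 60 horizontal strips of height \<open>r / 35\<close>.
\<close>

lemma lens_area_ge:
  fixes c :: "real ^ 2"
  assumes r: "0 < r"
  shows "1.12 * r\<^sup>2 \<le> measure lborel (ball c r \<inter> ball (c + vector [r, 0]) r)"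
proof -
  \<comment> \<open>In units of \<open>r\<close>, \<open>m k\<close> is the largest height occurring
    in strip \<open>k\<close>, up to sign, and \<open>w k\<close> is the half-width of the parabolic
    region at that height. Hence the box from \<open>lo k\<close> to \<open>hi k\<close> is
    inscribed in the region.\<close>
  define m :: "int \<Rightarrow> real" where "m k = of_int (max \<bar>k\<bar> \<bar>k + 1\<bar>) / 35" for k
  define w where "w k = 1 / 2 - 2 / 3 * (m k)\<^sup>2" for k
  define lo where "lo k = c + vector [r * (1 / 2 - w k), r * (of_int k / 35)]" for k
  define hi where "hi k = c + vector [r * (1 / 2 + w k), r * (of_int (k + 1) / 35)]" for k
  let ?I = "{-30..<30} :: int set"
  have m: "0 < m k" "m k \<le> 6 / 7" if "k \<in> ?I" for k
    using that by (auto simp: m_def max_def)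
  \<comment> \<open>In units of \<open>r\<close>, 3/4 is the squared height of the tips of the lens,
    where the parabolas and the circles all meet.\<close>
  have msq: "(m k)\<^sup>2 < 3 / 4" if "k \<in> ?I" for k
    using power_mono[of "m k" "6/7" 2] m[OF that] by (simp add: power2_eq_square)
  have w: "0 < w k" if "k \<in> ?I" for k
    using msq[OF that] by (simp add: w_def)
  have area: "measure lborel (box (lo k) (hi k)) = 2 * r\<^sup>2 * w k / 35" if "k \<in> ?I" for k
    using r w[OF that] by (subst content_rectangle)
      (auto simp: lo_def hi_def field_simps power2_eq_square)
  have disj: "disjoint_family_on (\<lambda>k. box (lo k) (hi k)) ?I"
  proof -
    have False if "k < l" "x \<in> box (lo k) (hi k)" "x \<in> box (lo l) (hi l)" for k l x
    proof -
      have "x $ 2 < c $ 2 + r * (of_int (k + 1) / 35)" "c $ 2 + r * (of_int l / 35) < x $ 2"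
        using that by (auto simp: mem_box_cart forall_2 lo_def hi_def)
      moreover have "r * (of_int (k + 1) / 35) \<le> r * (of_int l / 35)"
        using r that(1) by (intro mult_left_mono) auto
      ultimately show False by linarith
    qed
    then show ?thesis
      unfolding disjoint_family_on_def by (metis disjoint_iff linorder_neqE)
  qed
  have sub: "box (lo k) (hi k) \<subseteq> ball c r \<inter> ball (c + vector [r, 0]) r" if k: "k \<in> ?I" for k
  proof
    fix x assume x: "x \<in> box (lo k) (hi k)"
    define u where "u = (x $ 1 - c $ 1) / r"
    define v where "v = (x $ 2 - c $ 2) / r"
    have xu: "x $ 1 = c $ 1 + r * u" and xv: "x $ 2 = c $ 2 + r * v"
      using r by (simp_all add: u_def v_def)
    have u: "1 / 2 - w k < u" "u < 1 / 2 + w k" and v: "of_int k / 35 < v" "v < of_int (k + 1) / 35"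
      using x r by (auto simp: mem_box_cart forall_2 lo_def hi_def xu xv)
    have "\<bar>v\<bar> \<le> m k"
      using v by (auto simp: m_def max_def abs_if split: if_splits)
    then have v2: "v\<^sup>2 \<le> (m k)\<^sup>2"
      by (rule abs_le_square_iff[THEN iffD1, OF order_trans]) simp
    \<comment> \<open>Here \<open>t\<close> is the horizontal offset from either centre, later
      \<open>- u\<close> and \<open>1 - u\<close>. The extreme case is a far corner of the box at
      height \<open>m k\<close>.\<close>
    have key: "t\<^sup>2 + v\<^sup>2 < 1" if "\<bar>t\<bar> < 1 / 2 + w k" for t
    proof -
      have "t\<^sup>2 < (1 / 2 + w k)\<^sup>2"
        using that by (metis abs_ge_zero power2_abs power_strict_mono zero_less_numeral)
      moreover have "(1 / 2 + w k)\<^sup>2 + (m k)\<^sup>2 = 1 - (m k)\<^sup>2 * (1 / 3 - 4 / 9 * (m k)\<^sup>2)"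
        by (simp add: w_def power2_eq_square algebra_simps)
      moreover have "0 \<le> (m k)\<^sup>2 * (1 / 3 - 4 / 9 * (m k)\<^sup>2)"
        using msq[OF k] by (intro mult_nonneg_nonneg) auto
      ultimately show ?thesis using v2 by linarith
    qed
    have in_ball: "dist p x < r" if "p $ 1 - x $ 1 = r * t" "p $ 2 - x $ 2 = - r * v" "\<bar>t\<bar> < 1 / 2 + w k" for p t
    proof -
      have "(dist p x)\<^sup>2 = r\<^sup>2 * (t\<^sup>2 + v\<^sup>2)"
        unfolding dist_norm norm_2_squared vector_minus_component that
        by (simp add: power2_eq_square algebra_simps)
      also have "\<dots> < r\<^sup>2 * 1"
        using r key[OF that(3)] by (intro mult_strict_left_mono) auto
      finally show ?thesis
        using r by (simp add: power_less_imp_less_base)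
    qed
    show "x \<in> ball c r \<inter> ball (c + vector [r, 0]) r"
      using in_ball[of c "- u"] in_ball[of "c + vector [r, 0]" "1 - u"] u w[OF k]
      by (auto simp: xu xv algebra_simps)
  qed
  \<comment> \<open>The target is 1.12 * 35 / 2. Strips \<open>k\<close> and \<open>- k - 1\<close>
    have equal width, so the sum reduces to a sum of squares; at \<open>n = 30\<close> its value is
    about 19.71.\<close>
  have sum_w: "(\<Sum>k\<in>?I. w k) \<ge> 19.6"
  proof -
    have "(\<Sum>k\<in>{- int n..<int n}. w k) = real n - 2 * real (n * (n + 1) * (2 * n + 1)) / 11025" for n
    proof (induction n)
      case (Suc n)
      have "{- int (Suc n)..<int (Suc n)} = insert (- int n - 1) (insert (int n) {- int n..<int n})"
        by auto
      then have "(\<Sum>k\<in>{- int (Suc n)..<int (Suc n)}. w k) =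
          w (- int n - 1) + (w (int n) + (\<Sum>k\<in>{- int n..<int n}. w k))"
        by simp
      moreover have "w (- int n - 1) = 1 / 2 - 2 / 3 * ((real n + 1) / 35)\<^sup>2"
        "w (int n) = 1 / 2 - 2 / 3 * ((real n + 1) / 35)\<^sup>2"
        by (simp_all add: w_def m_def max_def)
      ultimately show ?case
        unfolding Suc.IH by (simp add: field_simps power2_eq_square)
    qed simp
    from this[of 30] show ?thesis by simp
  qed
  have "1.12 * r\<^sup>2 \<le> (\<Sum>k\<in>?I. 2 * r\<^sup>2 * w k / 35)"
  proof -
    have "(\<Sum>k\<in>?I. 2 * r\<^sup>2 * w k / 35) = 2 * r\<^sup>2 / 35 * (\<Sum>k\<in>?I. w k)"
      by (simp add: sum_distrib_left)
    moreover have "2 * r\<^sup>2 / 35 * 19.6 \<le> 2 * r\<^sup>2 / 35 * (\<Sum>k\<in>?I. w k)"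
      using sum_w by (intro mult_left_mono) auto
    ultimately show ?thesis by simp
  qed
  also have "\<dots> = measure lborel (\<Union>k\<in>?I. box (lo k) (hi k))"
    using lborel_finite_bounded[of "box (lo _) (hi _)"]
    by (subst measure_finite_Union[OF _ _ disj]) (auto intro!: sum.cong area[symmetric])
  also have "\<dots> \<le> measure lborel (ball c r \<inter> ball (c + vector [r, 0]) r)"
    by (intro measure_mono_fmeasurable UN_least sub)
      (auto intro!: fmeasurableI emeasure_bounded_finite bounded_Int)
  finally show ?thesis .
qed

lemma union_two_balls_area_le:
  fixes c :: "real ^ 2"
  assumes "0 < r"
  shows "measure lborel (ball c r \<union> ball (c + vector [r, 0]) r) \<le> (2 * pi - 1.12) * r\<^sup>2"
proof -
  have "ball p r \<in> fmeasurable lborel" for p :: "real ^ 2"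
    by (intro fmeasurableI emeasure_bounded_finite) auto
  then have "measure lborel (ball c r \<union> ball (c + vector [r, 0]) r) =
      2 * (pi * r\<^sup>2) - measure lborel (ball c r \<inter> ball (c + vector [r, 0]) r)"
    using assms by (subst measure_Un3) (simp_all add: circle_area)
  with lens_area_ge[OF assms, of c] show ?thesis by (simp add: algebra_simps)
qed

text \<open>Inversion is antitone on all of \<open>ennreal\<close>, including 0 and infinity. This
  suits the intensity, for which only an upper bound is established.\<close>

lemma ennreal_divide_mono_antimono:
  fixes a b :: ennreal
  assumes "a' \<le> a" "b \<le> b'"
  shows "a' / b' \<le> a / b"
proof -
  have "inverse b' \<le> inverse b"
    using assms(2) by (simp add: inverse_ennreal.rep_eq less_eq_ennreal.rep_eq ereal_inverse_antimono)
  then show ?thesis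
    unfolding divide_ennreal_def using assms(1) by (intro mult_mono) auto
qed

section \<open>A grid of cells in the unit square\<close>

definition grid_corner :: "nat \<Rightarrow> nat \<times> nat \<Rightarrow> real ^ 2" where
  "grid_corner n ij = vector [real (fst ij) / real n, real (snd ij) / real n]"

lemma unit_interval_grid:
  assumes "0 < n" "0 \<le> t" "t \<le> 1"
  shows "\<exists>i<n. real i / real n \<le> t \<and> t \<le> real i / real n + 1 / real n"
\<comment> \<open>At the right endpoint the floor would be \<open>n\<close>, just out of range; the
  last closed cell contains that point.\<close>
proof (cases "t = 1")
  case True
  then show ?thesis
    using assms(1) by (intro exI[of _ "n - 1"]) (auto simp: of_nat_diff field_simps)
next
  case False
  let ?i = "nat \<lfloor>t * real n\<rfloor>"
  have i: "real ?i \<le> t * real n" "t * real n < real ?i + 1"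
    using assms by (simp_all add: of_nat_nat)
  moreover have "t * real n < real n"
    using False assms by simp
  ultimately have "?i < n" by linarith
  then show ?thesis
    using i assms(1) by (intro exI[of _ ?i]) (auto simp: field_simps)
qed

text \<open>Closed cells serve the upper bound on the intensity, where every point must be counted
  and double counting on edges is harmless.\<close>

lemma unit_square_cover:
  assumes "0 < n"
  shows "cbox 0 (One :: real ^ 2) \<subseteq>
    (\<Union>p\<in>grid_corner n ` ({..<n} \<times> {..<n}). cbox p (p + vec (1 / real n)))"
proof
  fix x :: "real ^ 2" assume "x \<in> cbox 0 One"
  then have "0 \<le> x $ 1" "x $ 1 \<le> 1" "0 \<le> x $ 2" "x $ 2 \<le> 1"
    by (simp_all add: mem_unit_square)
  with unit_interval_grid[OF assms, of "x $ 1"] unit_interval_grid[OF assms, of "x $ 2"]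
  obtain i j where "i < n" "j < n"
    "real i / real n \<le> x $ 1" "x $ 1 \<le> real i / real n + 1 / real n"
    "real j / real n \<le> x $ 2" "x $ 2 \<le> real j / real n + 1 / real n"
    by blast
  then have "x \<in> cbox (grid_corner n (i, j)) (grid_corner n (i, j) + vec (1 / real n))"
    by (simp add: mem_square grid_corner_def)
  then show "x \<in> (\<Union>p\<in>grid_corner n ` ({..<n} \<times> {..<n}). cbox p (p + vec (1 / real n)))"
    using \<open>i < n\<close> \<open>j < n\<close> by blast
qed

lemma unit_square_grid_subset:
  assumes "0 < n" "ij \<in> {..<n} \<times> {..<n}"
  shows "box (grid_corner n ij) (grid_corner n ij + vec (1 / real n)) \<subseteq> cbox 0 (One :: real ^ 2)"
proof
  fix x assume x: "x \<in> box (grid_corner n ij) (grid_corner n ij + vec (1 / real n))"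
  obtain i j where ij: "ij = (i, j)" "i < n" "j < n"
    using assms(2) by auto
  have le: "real k / real n + 1 / real n \<le> 1" if "k < n" for k
    using that assms(1) by (simp add: field_simps)
  have ge: "0 \<le> real k / real n" for k
    by simp
  have "real i / real n < x $ 1" "x $ 1 < real i / real n + 1 / real n"
    "real j / real n < x $ 2" "x $ 2 < real j / real n + 1 / real n"
    using x by (simp_all add: mem_square grid_corner_def ij(1))
  then show "x \<in> cbox 0 One"
    unfolding mem_unit_square using le[OF ij(2)] le[OF ij(3)] ge[of i] ge[of j] by linarith
qed

text \<open>Open cells serve the lower bound on the Palm sum, where no point may be counted twice
  and losing the edges is harmless.\<close>

lemma grid_cells_disjoint:
  assumes "0 < n"
  shows "disjoint_family_on (\<lambda>ij. box (grid_corner n ij) (grid_corner n ij + vec (1 / real n))) I"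
proof -
  have eq: "k = l" if "real k / real n < t" "t < real k / real n + 1 / real n"
      "real l / real n < t" "t < real l / real n + 1 / real n" for k l t
  proof -
    have "real k < t * real n" "t * real n < real k + 1" "real l < t * real n" "t * real n < real l + 1"
      using that assms by (simp_all add: field_simps)
    then show ?thesis by linarith
  qed
  show ?thesis
    unfolding disjoint_family_on_def
    by (auto simp: mem_square grid_corner_def dest: eq)
qed

section \<open>Upper bound on the intensity\<close>

text \<open>Triangle inequality through the corner \<open>p\<close>: points of one cell are at most
  \<open>4 * s\<close> apart, and a parent point within \<open>\<delta> - 2 * s\<close> of
  \<open>p\<close> is closer than \<open>\<delta>\<close> to \<open>x\<close>. Both exclude a second
  parent point.\<close>

lemma matern_I_cell_isolated:
  assumes x: "x \<in> matern_I \<delta> \<phi>" "x \<in> cbox p (p + vec s)" and s: "4 * s < \<delta>"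
  shows "isolated_config 1 (\<lambda>_. cbox p (p + vec s)) (ball p (\<delta> - 2 * s)) \<phi>"
    and "matern_I \<delta> \<phi> \<inter> cbox p (p + vec s) = {x}"
proof -
  have far: "\<delta> \<le> dist x y" if "y \<in> \<phi>" "y \<noteq> x" for y
    using x(1) that by (auto simp: matern_I_def)
  have px: "dist x p \<le> 2 * s"
    using x(2) by (rule dist_square_corner)
  have *: "y = x" if "y \<in> \<phi>" "y \<in> cbox p (p + vec s)" for y
  proof (rule ccontr)
    assume "y \<noteq> x"
    with far that(1) have "\<delta> \<le> dist x y" by blast
    then show False
      using dist_square_corner[OF that(2)] px s dist_triangle2[of x y p] by linarith
  qed
  have "x \<in> \<phi>"
    using x(1) by (simp add: matern_I_def)
  then have one: "\<phi> \<inter> cbox p (p + vec s) = {x}"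
    using * x(2) by blast
  have "y = x" if "y \<in> \<phi>" "y \<in> ball p (\<delta> - 2 * s)" for y
  proof (rule ccontr)
    assume "y \<noteq> x"
    with far that(1) have "\<delta> \<le> dist x y" by blast
    then show False
      using that(2) px dist_triangle[of x y p] by (simp add: dist_commute)
  qed
  then have "\<phi> \<inter> ball p (\<delta> - 2 * s) \<subseteq> cbox p (p + vec s)"
    using x(2) by blast
  with one show "isolated_config 1 (\<lambda>_. cbox p (p + vec s)) (ball p (\<delta> - 2 * s)) \<phi>"
    by (simp add: isolated_config_def lessThan_Suc)
  show "matern_I \<delta> \<phi> \<inter> cbox p (p + vec s) = {x}"
    using one x unfolding matern_I_def by blast
qed

text \<open>Each cell contributes at most the indicator of its isolated configuration. The areas of
  the cells sum to 1, so \<open>n\<close> survives only in the margin of the radius.\<close>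

lemma intensity_matern_I_le:
  assumes ppp: "stationary_ppp \<rho> P \<Psi>" and \<rho>: "0 < \<rho>" and n: "0 < n" and s: "4 / real n < \<delta>"
  shows "intensity P (\<lambda>\<omega>. matern_I \<delta> (\<Psi> \<omega>)) \<le> ennreal (\<rho> * exp (- (\<rho> * (pi * (\<delta> - 2 / real n)\<^sup>2))))"
proof -
  interpret prob_space P
    using ppp unfolding stationary_ppp_def by blast
  define I where "I = {..<n} \<times> {..<n}"
  define S where "S ij = cbox (grid_corner n ij) (grid_corner n ij + vec (1 / real n))" for ij
  define U where "U ij = ball (grid_corner n ij) (\<delta> - 2 / real n)" for ij
  define A where "A ij = {\<omega> \<in> space P. isolated_config 1 (\<lambda>_. S ij) (U ij) (\<Psi> \<omega>)}" for ij
  have fin: "finite I"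
    by (simp add: I_def)
  have sub: "S ij \<subseteq> U ij" for ij
    using dist_square_corner[of _ "grid_corner n ij" "1 / real n"] s
    by (fastforce simp: S_def U_def dist_commute)
  have A: "A ij \<in> sets P"
      "prob (A ij) = \<rho> * (1 / real n)\<^sup>2 * exp (- (\<rho> * (pi * (\<delta> - 2 / real n)\<^sup>2)))" for ij
  proof -
    have SU: "S ij \<in> sets borel" "U ij \<in> sets borel" "bounded (U ij)"
      by (auto simp: S_def U_def)
    have disj: "disjoint_family_on (\<lambda>_. S ij) {..<1::nat}"
      by (simp add: disjoint_family_on_def)
    note iso = stationary_ppp_isolated_config[OF ppp SU(1) sub disj SU(2,3)]
    show "A ij \<in> sets P"
      unfolding A_def by (rule iso(1))
    have "measure lborel (S ij) = (1 / real n)\<^sup>2"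
      unfolding S_def by (subst content_rectangle) (auto simp: power2_eq_square)
    moreover have "measure lborel (U ij) = pi * (\<delta> - 2 / real n)\<^sup>2"
      unfolding U_def using s n by (subst circle_area) (auto simp: field_simps)
    ultimately show "prob (A ij) = \<rho> * (1 / real n)\<^sup>2 * exp (- (\<rho> * (pi * (\<delta> - 2 / real n)\<^sup>2)))"
      unfolding A_def using iso(2) by simp
  qed
  have pw: "emeasure (count_space UNIV) (matern_I \<delta> (\<Psi> \<omega>) \<inter> cbox 0 One) \<le> (\<Sum>ij\<in>I. indicator (A ij) \<omega>)"
    if \<omega>: "\<omega> \<in> space P" for \<omega>
  proof -
    let ?\<Phi> = "matern_I \<delta> (\<Psi> \<omega>)"
    have "?\<Phi> \<inter> cbox 0 One \<subseteq> (\<Union>ij\<in>I. ?\<Phi> \<inter> S ij)"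
      using unit_square_cover[OF n] by (auto simp: I_def S_def)
    then have "emeasure (count_space UNIV) (?\<Phi> \<inter> cbox 0 One) \<le>
        emeasure (count_space UNIV) (\<Union>ij\<in>I. ?\<Phi> \<inter> S ij)"
      by (intro emeasure_mono) auto
    also have "\<dots> \<le> (\<Sum>ij\<in>I. emeasure (count_space UNIV) (?\<Phi> \<inter> S ij))"
      using fin by (intro emeasure_subadditive_finite) auto
    also have "\<dots> \<le> (\<Sum>ij\<in>I. indicator (A ij) \<omega>)"
    proof (rule sum_mono)
      fix ij
      show "emeasure (count_space UNIV) (?\<Phi> \<inter> S ij) \<le> indicator (A ij) \<omega>"
      proof (cases "?\<Phi> \<inter> S ij = {}")
        case False
        then obtain x where "x \<in> ?\<Phi>" "x \<in> S ij" by blast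
        with matern_I_cell_isolated[of x \<delta> "\<Psi> \<omega>" "grid_corner n ij" "1 / real n"] s
        have "\<omega> \<in> A ij" "?\<Phi> \<inter> S ij = {x}"
          using \<omega> by (simp_all add: A_def S_def U_def)
        then show ?thesis by simp
      qed simp
    qed
    finally show ?thesis .
  qed
  \<comment> \<open>Monotonicity of the nonnegative integral asks for no measurability of the counts
    of retained points; only the events \<open>A ij\<close> are measured.\<close>
  have "intensity P (\<lambda>\<omega>. matern_I \<delta> (\<Psi> \<omega>)) \<le> (\<integral>\<^sup>+\<omega>. (\<Sum>ij\<in>I. indicator (A ij) \<omega>) \<partial>P)"
    unfolding intensity_def by (intro nn_integral_mono pw)
  also have "\<dots> = (\<Sum>ij\<in>I. emeasure P (A ij))"
    using A(1) by (simp add: nn_integral_sum)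
  also have "\<dots> = ennreal (\<Sum>ij\<in>I. prob (A ij))"
    by (simp add: emeasure_eq_measure)
  also have "(\<Sum>ij\<in>I. prob (A ij)) = \<rho> * exp (- (\<rho> * (pi * (\<delta> - 2 / real n)\<^sup>2)))"
    using n unfolding A(2) by (simp add: I_def power2_eq_square)
  finally show ?thesis .
qed

section \<open>Fading, and pairs of retained points\<close>

text \<open>All summands except that of \<open>z\<close> are dropped, and its fading coefficient
  averages to 1.\<close>

lemma fading_interference_ge_point:
  assumes fad: "fading H h" and z: "z \<in> \<phi>" and g: "0 \<le> g (norm z)"
  shows "ennreal (g (norm z)) \<le> (\<integral>\<^sup>+\<eta>. interference (\<lambda>x. h x \<eta>) g \<phi> \<partial>H)"
proof -
  have h: "h z \<in> borel_measurable H" "\<And>\<eta>. \<eta> \<in> space H \<Longrightarrow> 0 \<le> h z \<eta>" "integral\<^sup>L H (h z) = 1"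
    using fad by (auto simp: fading_def)
  \<comment> \<open>A non-integrable function has Bochner integral 0 by default, so the value 1
    forces integrability.\<close>
  have "integrable H (h z)"
    using h(3) by (metis not_integrable_integral_eq zero_neq_one)
  then have one: "(\<integral>\<^sup>+\<eta>. ennreal (h z \<eta>) \<partial>H) = 1"
    using h by (subst nn_integral_eq_integral) auto
  have "ennreal (g (norm z)) = (\<integral>\<^sup>+\<eta>. ennreal (h z \<eta>) * ennreal (g (norm z)) \<partial>H)"
    using h(1) one by (simp add: nn_integral_multc)
  also have "\<dots> \<le> (\<integral>\<^sup>+\<eta>. interference (\<lambda>x. h x \<eta>) g \<phi> \<partial>H)"
  proof (rule nn_integral_mono)
    fix \<eta> assume "\<eta> \<in> space H"
    then have "ennreal (h z \<eta>) * ennreal (g (norm z)) = ennreal (h z \<eta> * g (norm z))"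
      using h(2) g by (simp add: ennreal_mult)
    also have "\<dots> \<le> interference (\<lambda>x. h x \<eta>) g \<phi>"
      unfolding interference_def using z by (rule nn_integral_ge_point)
    finally show "ennreal (h z \<eta>) * ennreal (g (norm z)) \<le> interference (\<lambda>x. h x \<eta>) g \<phi>" .
  qed
  finally show ?thesis .
qed

text \<open>The first cell belongs to the fine grid (\<open>s = 1 / n\<close>), while the second
  keeps the coarse side \<open>t\<close>, so that its probability does not shrink with
  \<open>n\<close>. The length \<open>r\<close> has two roles: as offset it separates the cells by
  at least \<open>\<delta>\<close>, and as radius it makes each disk contain everything within
  \<open>\<delta>\<close> of a point of its cell.\<close>

definition pair_config :: "real \<Rightarrow> real \<Rightarrow> real \<Rightarrow> real ^ 2 \<Rightarrow> (real ^ 2) set \<Rightarrow> bool" where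
  "pair_config \<delta> s t p \<phi> \<longleftrightarrow>
     (let r = \<delta> + 2 * t; q = p + vector [r, 0] in
      isolated_config 2 (\<lambda>i. if i = 0 then box p (p + vec s) else cbox q (q + vec t))
        (ball p r \<union> ball q r) \<phi>)"

lemma pair_config_cells_far:
  fixes x y p :: "real ^ 2"
  assumes "x \<in> box p (p + vec s)" "y \<in> cbox (p + vector [\<delta> + 2 * t, 0]) (p + vector [\<delta> + 2 * t, 0] + vec t)"
    and "s \<le> t"
  shows "\<delta> \<le> dist x y"
proof -
  have "\<delta> \<le> (y - x) $ 1"
    using assms by (simp add: mem_square)
  also have "\<dots> \<le> norm (y - x)"
    using component_le_norm_cart[of "y - x" 1] by linarith
  finally show ?thesis
    by (simp add: dist_norm norm_minus_commute)
qed

text \<open>A parent point closer than \<open>\<delta>\<close> to \<open>x\<close> or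
  \<open>y\<close> lies in \<open>U\<close>, hence is \<open>x\<close> or \<open>y\<close>, and
  these two are at least \<open>\<delta>\<close> apart. The upper bound on their distance comes from
  \<open>2 * s + r + 2 * t\<close>, which is at most \<open>\<delta> + 6 * t\<close>.\<close>

lemma pair_configD:
  assumes iso: "pair_config \<delta> s t p \<phi>" and st: "s \<le> t" "0 < s" "8 * t \<le> \<delta>"
  shows "\<exists>x\<in>matern_I \<delta> \<phi> \<inter> box p (p + vec s). \<exists>y\<in>matern_I \<delta> \<phi>. \<delta> \<le> dist x y \<and> dist x y \<le> 2 * \<delta>"
proof -
  define r where "r = \<delta> + 2 * t"
  define q where "q = p + vector [r, 0]"
  define S where "S = box p (p + vec s)"
  define T where "T = cbox q (q + vec t)"
  define U where "U = ball p r \<union> ball q r"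
  have iso: "is_singleton (\<phi> \<inter> S)" "is_singleton (\<phi> \<inter> T)" "\<phi> \<inter> U \<subseteq> S \<union> T"
    using iso by (force simp: pair_config_def isolated_config_def S_def T_def U_def q_def r_def Let_def
        less_2_cases_iff split: if_splits)+
  from iso(1,2) obtain x y where x: "\<phi> \<inter> S = {x}" and y: "\<phi> \<inter> T = {y}"
    by (auto simp: is_singleton_def)
  have xS: "x \<in> S" "x \<in> \<phi>" and yT: "y \<in> T" "y \<in> \<phi>"
    using x y by auto
  have S_near: "dist x p \<le> 2 * s"
    using xS box_subset_cbox[of p "p + vec s"] by (intro dist_square_corner) (auto simp: S_def)
  have T_near: "dist y q \<le> 2 * t"
    using yT by (intro dist_square_corner) (auto simp: T_def)
  have only: "u \<in> {x, y}" if "u \<in> \<phi>" "u \<in> U" for u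
    using that iso(3) x y by blast
  have far: "\<delta> \<le> dist x y"
    using pair_config_cells_far[OF _ _ st(1)] xS yT by (simp add: S_def T_def q_def r_def)
  have "dist p q = r"
    using st by (simp add: q_def r_def dist_norm norm_vec_def L2_set_def sum_2)
  then have near: "dist x y \<le> 2 * \<delta>"
    using S_near T_near dist_triangle[of x y p] dist_triangle[of p y q] st
    by (simp add: r_def dist_commute)
  have "x \<in> matern_I \<delta> \<phi>"
  proof -
    have "\<delta> \<le> dist x u" if "u \<in> \<phi>" "u \<noteq> x" for u
    proof (rule ccontr)
      assume "\<not> \<delta> \<le> dist x u"
      then have "u \<in> U"
        using S_near dist_triangle[of p u x] st(1) by (simp add: U_def r_def dist_commute)
      then show False
        using only[OF that(1)] that(2) far \<open>\<not> \<delta> \<le> dist x u\<close> by auto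
    qed
    with xS show ?thesis by (auto simp: matern_I_def)
  qed
  moreover have "y \<in> matern_I \<delta> \<phi>"
  proof -
    have "\<delta> \<le> dist y u" if "u \<in> \<phi>" "u \<noteq> y" for u
    proof (rule ccontr)
      assume "\<not> \<delta> \<le> dist y u"
      then have "u \<in> U"
        using T_near dist_triangle[of q u y] by (simp add: U_def r_def dist_commute)
      then show False
        using only[OF that(1)] that(2) far \<open>\<not> \<delta> \<le> dist y u\<close> by (auto simp: dist_commute)
    qed
    with yT show ?thesis by (auto simp: matern_I_def)
  qed
  ultimately show ?thesis
    using xS far near by (auto simp: S_def)
qed

text \<open>An inequality, because the area of the two disks enters through the upper bound given by
  the lens.\<close>

lemma prob_pair_config_ge:
  assumes ppp: "stationary_ppp \<rho> P \<Psi>" and \<rho>: "0 < \<rho>" and st: "0 < s" "s \<le> t" "0 < \<delta>"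
  shows "{\<omega> \<in> space P. pair_config \<delta> s t p (\<Psi> \<omega>)} \<in> sets P" (is "?E \<in> _")
    and "\<rho> * s\<^sup>2 * (\<rho> * t\<^sup>2) * exp (- (\<rho> * ((2 * pi - 1.12) * (\<delta> + 2 * t)\<^sup>2)))
      \<le> measure P {\<omega> \<in> space P. pair_config \<delta> s t p (\<Psi> \<omega>)}"
proof -
  define r where "r = \<delta> + 2 * t"
  define q where "q = p + vector [r, 0]"
  define S where "S i = (if i = 0 then box p (p + vec s) else cbox q (q + vec t))" for i :: nat
  define U where "U = ball p r \<union> ball q r"
  have E: "?E = {\<omega> \<in> space P. isolated_config 2 S U (\<Psi> \<omega>)}"
    unfolding pair_config_def Let_def S_def[abs_def] U_def q_def r_def by simp
  have S: "S i \<in> sets borel" for i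
    by (simp add: S_def)
  have sub: "S i \<subseteq> U" for i
  proof
    fix x assume x: "x \<in> S i"
    show "x \<in> U"
    proof (cases "i = 0")
      case True
      then have "dist x p \<le> 2 * s"
        using x box_subset_cbox[of p "p + vec s"] by (intro dist_square_corner) (auto simp: S_def)
      then show ?thesis
        using st by (simp add: U_def r_def dist_commute)
    next
      case False
      then have "dist x q \<le> 2 * t"
        using x by (intro dist_square_corner) (auto simp: S_def)
      then show ?thesis
        using st by (simp add: U_def r_def dist_commute)
    qed
  qed
  have "S 0 \<inter> S 1 = {}"
    using pair_config_cells_far[OF _ _ st(2), of _ p _ \<delta>] st(3)
    by (force simp: S_def q_def r_def)
  then have disj: "disjoint_family_on S {..<2}"
    by (auto simp: disjoint_family_on_def less_2_cases_iff)
  have U: "U \<in> sets borel" "bounded U"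
    by (auto simp: U_def)
  note iso = stationary_ppp_isolated_config[OF ppp S sub disj U]
  show "?E \<in> sets P"
    unfolding E by (rule iso(1))
  have "measure lborel (S 0) = s\<^sup>2" "measure lborel (S 1) = t\<^sup>2"
    using st by (simp_all add: S_def content_rectangle power2_eq_square)
  then have "measure P ?E = \<rho> * s\<^sup>2 * (\<rho> * t\<^sup>2) * exp (- (\<rho> * measure lborel U))"
    unfolding E iso(2) by (simp add: numeral_2_eq_2)
  moreover have "measure lborel U \<le> (2 * pi - 1.12) * r\<^sup>2"
    unfolding U_def q_def using st by (intro union_two_balls_area_le) (simp add: r_def)
  then have "exp (- (\<rho> * ((2 * pi - 1.12) * r\<^sup>2))) \<le> exp (- (\<rho> * measure lborel U))"
    using \<rho> by simp
  ultimately show "\<rho> * s\<^sup>2 * (\<rho> * t\<^sup>2) * exp (- (\<rho> * ((2 * pi - 1.12) * (\<delta> + 2 * t)\<^sup>2)))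
      \<le> measure P ?E"
    using \<rho> unfolding r_def by (simp add: mult_left_mono)
qed

section \<open>The Poisson reference interference\<close>

lemma nn_integral_power_tail:
  assumes \<alpha>: "2 < \<alpha>" and \<delta>: "0 < \<delta>"
  shows "(\<integral>\<^sup>+r\<in>{\<delta>..}. ennreal (r powr (- \<alpha>) * r) \<partial>lborel) = ennreal (\<delta> powr (2 - \<alpha>) / (\<alpha> - 2))"
proof -
  define F where "F r = - (r powr (2 - \<alpha>) / (\<alpha> - 2))" for r :: real
  have deriv: "DERIV F r :> r powr (- \<alpha>) * r" if "\<delta> \<le> r" for r
  proof -
    have r: "0 < r" using that \<delta> by simp
    have "DERIV F r :> - ((2 - \<alpha>) * r powr (2 - \<alpha> - 1) / (\<alpha> - 2))"
      unfolding F_def using r \<alpha> by (auto intro!: derivative_eq_intros)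
    moreover have "(2 - \<alpha>) / (\<alpha> - 2) = - 1"
      using \<alpha> by (simp add: field_simps)
    then have "- ((2 - \<alpha>) * r powr (2 - \<alpha> - 1) / (\<alpha> - 2)) = r powr (2 - \<alpha> - 1)"
      by (metis minus_mult_minus mult.left_neutral mult_minus_left times_divide_eq_left)
    moreover have "r powr (2 - \<alpha> - 1) = r powr (- \<alpha>) * r"
      using r powr_add[of r "- \<alpha>" 1] by simp
    ultimately show ?thesis by simp
  qed
  have "((\<lambda>r. r powr (2 - \<alpha>)) \<longlongrightarrow> 0) at_top"
    using \<alpha> by (intro tendsto_neg_powr) (auto simp: filterlim_ident)
  then have "(F \<longlongrightarrow> - (0 / (\<alpha> - 2))) at_top"
    unfolding F_def using \<alpha> by (intro tendsto_intros) auto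
  then have lim: "(F \<longlongrightarrow> 0) at_top" by simp
  have "(\<integral>\<^sup>+r\<in>{\<delta>..}. ennreal (r powr (- \<alpha>) * r) \<partial>lborel) = ennreal (0 - F \<delta>)"
    by (rule nn_integral_FTC_atLeast[OF _ deriv _ lim]) (use \<delta> in auto)
  then show ?thesis by (simp add: F_def)
qed

text \<open>As \<open>r0 \<le> \<delta>\<close>, the cutoff never acts on the range of integration,
  and the value is free of \<open>r0\<close>.\<close>

lemma ppp_mean_interference_power_path_loss:
  assumes \<alpha>: "2 < \<alpha>" and \<delta>: "0 < \<delta>" and r0: "r0 \<le> \<delta>"
  shows "ppp_mean_interference \<kappa> \<delta> (power_path_loss \<alpha> r0) =
    ennreal (2 * pi) * \<kappa> * ennreal (\<delta> powr (2 - \<alpha>) / (\<alpha> - 2))"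
proof -
  have "(\<integral>\<^sup>+r\<in>{\<delta>..}. ennreal (power_path_loss \<alpha> r0 r * r) \<partial>lborel) =
      (\<integral>\<^sup>+r\<in>{\<delta>..}. ennreal (r powr (- \<alpha>) * r) \<partial>lborel)"
    using r0 by (intro nn_integral_cong) (auto simp: power_path_loss_def indicator_def max_def)
  then show ?thesis
    unfolding ppp_mean_interference_def by (simp add: nn_integral_power_tail[OF \<alpha> \<delta>])
qed

section \<open>Lower bound on the Palm mean interference\<close>

text \<open>Seen from \<open>x\<close>, the partner \<open>y\<close> alone suffices: its distance is
  at least \<open>r0\<close>, so the pure power law applies, and at most
  \<open>2 * \<delta>\<close>.\<close>

lemma pair_config_palm_sum_ge:
  assumes fad: "fading H h" and st: "0 < s" "s \<le> t" "8 * t \<le> \<delta>"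
    and \<alpha>: "0 \<le> \<alpha>" and r0: "r0 \<le> \<delta>"
    and pair: "pair_config \<delta> s t p \<phi>"
  shows "\<exists>x\<in>matern_I \<delta> \<phi> \<inter> box p (p + vec s).
    ennreal ((2 * \<delta>) powr (- \<alpha>)) \<le>
      (\<integral>\<^sup>+\<eta>. interference (\<lambda>x. h x \<eta>) (power_path_loss \<alpha> r0)
        ((\<lambda>y. y - x) ` (matern_I \<delta> \<phi> - {x})) \<partial>H)"
proof -
  obtain x y where x: "x \<in> matern_I \<delta> \<phi> \<inter> box p (p + vec s)" and y: "y \<in> matern_I \<delta> \<phi>"
    and d: "\<delta> \<le> dist x y" "dist x y \<le> 2 * \<delta>"
    using pair_configD[OF pair st(2,1,3)] by blast
  have \<delta>: "0 < \<delta>" using st by linarith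
  then have "x \<noteq> y" using d by auto
  then have z: "y - x \<in> (\<lambda>y. y - x) ` (matern_I \<delta> \<phi> - {x})"
    using y by auto
  have n: "norm (y - x) = dist x y"
    by (simp add: dist_norm norm_minus_commute)
  have "(2 * \<delta>) powr (- \<alpha>) \<le> dist x y powr (- \<alpha>)"
    using \<alpha> \<delta> d by (intro powr_mono2') auto
  also have "\<dots> = power_path_loss \<alpha> r0 (norm (y - x))"
    using r0 d by (simp add: power_path_loss_def n max_def)
  finally have "ennreal ((2 * \<delta>) powr (- \<alpha>)) \<le> ennreal (power_path_loss \<alpha> r0 (norm (y - x)))"
    by (rule ennreal_leI)
  also have "\<dots> \<le> (\<integral>\<^sup>+\<eta>. interference (\<lambda>x. h x \<eta>) (power_path_loss \<alpha> r0)
        ((\<lambda>y. y - x) ` (matern_I \<delta> \<phi> - {x})) \<partial>H)"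
    by (rule fading_interference_ge_point[OF fad z]) (simp add: power_path_loss_def)
  finally show ?thesis using x by blast
qed

text \<open>Disjointness of the \<open>S i\<close> makes the witnesses distinct, so no value of
  \<open>F\<close> is charged twice. Cells with \<open>a i = 0\<close> supply no witness.\<close>

lemma sum_le_nn_integral_count_space:
  fixes a :: "'i \<Rightarrow> ennreal"
  assumes I: "finite I" and disj: "disjoint_family_on S I" and sub: "\<And>i. i \<in> I \<Longrightarrow> S i \<subseteq> Q"
    and a: "\<And>i. i \<in> I \<Longrightarrow> a i \<noteq> 0 \<Longrightarrow> \<exists>x\<in>A \<inter> S i. a i \<le> F x"
  shows "(\<Sum>i\<in>I. a i) \<le> (\<integral>\<^sup>+x. F x \<partial>count_space (A \<inter> Q))"
proof -
  have "(\<Sum>i\<in>I. a i) \<le> (\<Sum>i\<in>I. \<integral>\<^sup>+x. F x * indicator (S i) x \<partial>count_space (A \<inter> Q))"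
  proof (rule sum_mono)
    fix i assume i: "i \<in> I"
    show "a i \<le> (\<integral>\<^sup>+x. F x * indicator (S i) x \<partial>count_space (A \<inter> Q))"
    proof (cases "a i = 0")
      case False
      with a[OF i] obtain x where x: "x \<in> A \<inter> S i" "a i \<le> F x" by blast
      with nn_integral_ge_point[of x "A \<inter> Q" "\<lambda>x. F x * indicator (S i) x"] sub[OF i]
      show ?thesis by (auto intro: order_trans)
    qed simp
  qed
  also have "\<dots> = (\<integral>\<^sup>+x. (\<Sum>i\<in>I. F x * indicator (S i) x) \<partial>count_space (A \<inter> Q))"
    by (simp add: nn_integral_sum)
  also have "\<dots> \<le> (\<integral>\<^sup>+x. F x \<partial>count_space (A \<inter> Q))"
  proof (rule nn_integral_mono)
    fix x
    have "(\<Sum>i\<in>I. F x * indicator (S i) x) = F x * indicator (\<Union>i\<in>I. S i) x"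
      using I disj by (simp add: sum_distrib_left[symmetric] indicator_UN_disjoint)
    also have "\<dots> \<le> F x"
      by (simp add: indicator_def)
    finally show "(\<Sum>i\<in>I. F x * indicator (S i) x) \<le> F x" .
  qed
  finally show ?thesis .
qed

text \<open>The Palm sum is at least \<open>G\<close> times the number of cells with a pair
  configuration; in expectation the \<open>n\<^sup>2\<close> cells cancel the factor
  \<open>(1 / real n)\<^sup>2\<close>. The division by the intensity is the Palm
  normalisation.\<close>

lemma palm_mean_interference_matern_I_ge:
  assumes ppp: "stationary_ppp \<rho> P \<Psi>" and fad: "fading H h" and \<rho>: "0 < \<rho>"
    and n: "0 < n" and nt: "1 / real n \<le> t" "8 * t \<le> \<delta>" and \<alpha>: "0 \<le> \<alpha>" and r0: "r0 \<le> \<delta>"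
  shows "ennreal ((2 * \<delta>) powr (- \<alpha>) *
      (\<rho>\<^sup>2 * t\<^sup>2 * exp (- (\<rho> * ((2 * pi - 1.12) * (\<delta> + 2 * t)\<^sup>2))))) / intensity P (\<lambda>\<omega>. matern_I \<delta> (\<Psi> \<omega>))
    \<le> palm_mean_interference P (\<lambda>\<omega>. matern_I \<delta> (\<Psi> \<omega>)) H h (power_path_loss \<alpha> r0)"
proof -
  interpret prob_space P
    using ppp unfolding stationary_ppp_def by blast
  define I where "I = {..<n} \<times> {..<n}"
  define S where "S ij = box (grid_corner n ij) (grid_corner n ij + vec (1 / real n))" for ij
  define A where "A ij = {\<omega> \<in> space P. pair_config \<delta> (1 / real n) t (grid_corner n ij) (\<Psi> \<omega>)}" for ij
  define G where "G = (2 * \<delta>) powr (- \<alpha>)"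
  define p where "p = exp (- (\<rho> * ((2 * pi - 1.12) * (\<delta> + 2 * t)\<^sup>2)))"
  define F where "F \<omega> x = (\<integral>\<^sup>+\<eta>. interference (\<lambda>x. h x \<eta>) (power_path_loss \<alpha> r0)
        ((\<lambda>y. y - x) ` (matern_I \<delta> (\<Psi> \<omega>) - {x})) \<partial>H)" for \<omega> x
  have s: "0 < 1 / real n" using n by simp
  have \<delta>: "0 < \<delta>" using s nt by linarith
  have I: "finite I" "card I = n\<^sup>2"
    by (simp_all add: I_def power2_eq_square)
  have A: "A ij \<in> sets P" "\<rho> * (1 / real n)\<^sup>2 * (\<rho> * t\<^sup>2) * p \<le> prob (A ij)" for ij
    unfolding A_def p_def by (intro prob_pair_config_ge[OF ppp \<rho> s nt(1) \<delta>])+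
  have pw: "(\<Sum>ij\<in>I. ennreal G * indicator (A ij) \<omega>) \<le>
      (\<integral>\<^sup>+x. F \<omega> x \<partial>count_space (matern_I \<delta> (\<Psi> \<omega>) \<inter> cbox 0 One))" for \<omega>
  proof (rule sum_le_nn_integral_count_space[OF I(1), where S = S])
    show "disjoint_family_on S I"
      unfolding S_def[abs_def] by (rule grid_cells_disjoint[OF n])
    show "S ij \<subseteq> cbox 0 One" if "ij \<in> I" for ij
      unfolding S_def using that by (intro unit_square_grid_subset[OF n]) (simp add: I_def)
    show "\<exists>x\<in>matern_I \<delta> (\<Psi> \<omega>) \<inter> S ij. ennreal G * indicator (A ij) \<omega> \<le> F \<omega> x"
      if "ennreal G * indicator (A ij) \<omega> \<noteq> 0" for ij
    proof -
      have \<omega>: "\<omega> \<in> A ij"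
        using that by (auto simp: indicator_def split: if_splits)
      then show ?thesis
        using pair_config_palm_sum_ge[OF fad s nt \<alpha> r0, of "grid_corner n ij" "\<Psi> \<omega>"]
        by (simp add: A_def S_def F_def G_def)
    qed
  qed
  have "G * (\<rho>\<^sup>2 * t\<^sup>2 * p) = (\<Sum>ij\<in>I. G * (\<rho> * (1 / real n)\<^sup>2 * (\<rho> * t\<^sup>2) * p))"
    using n by (simp add: I(2) power2_eq_square)
  also have "\<dots> \<le> (\<Sum>ij\<in>I. G * prob (A ij))"
    using A(2) by (intro sum_mono mult_left_mono) (simp_all add: G_def)
  finally have "ennreal (G * (\<rho>\<^sup>2 * t\<^sup>2 * p)) \<le> ennreal (\<Sum>ij\<in>I. G * prob (A ij))"
    by (rule ennreal_leI)
  also have "\<dots> = (\<Sum>ij\<in>I. ennreal G * emeasure P (A ij))"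
    by (simp add: emeasure_eq_measure G_def ennreal_mult sum_nonneg flip: sum_ennreal)
  also have "\<dots> = (\<integral>\<^sup>+\<omega>. (\<Sum>ij\<in>I. ennreal G * indicator (A ij) \<omega>) \<partial>P)"
    using A(1) by (simp add: nn_integral_sum nn_integral_cmult)
  also have "\<dots> \<le> (\<integral>\<^sup>+\<omega>. (\<integral>\<^sup>+x. F \<omega> x \<partial>count_space (matern_I \<delta> (\<Psi> \<omega>) \<inter> cbox 0 One)) \<partial>P)"
    by (intro nn_integral_mono pw)
  finally show ?thesis
    unfolding palm_mean_interference_def reduced_palm_expectation_def G_def p_def F_def
    by (rule divide_right_mono_ennreal)
qed

section \<open>Comparison of exponents and the final bound\<close>

text \<open>
  The ratio 500 is chosen so that \<open>1.12 * (251 / 250)\<^sup>2 - 16 * pi / 500\<close> still exceeds 1.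
\<close>

lemma exponent_gain:
  fixes \<rho> \<delta> :: real
  assumes "0 < \<rho>"
  shows "\<rho> * \<delta>\<^sup>2 \<le> 2 * (\<rho> * (pi * (\<delta> - 2 * (\<delta> / 500))\<^sup>2)) - \<rho> * ((2 * pi - 1.12) * (\<delta> + 2 * (\<delta> / 500))\<^sup>2)"
proof -
  have "2 * (\<rho> * (pi * (\<delta> - 2 * (\<delta> / 500))\<^sup>2)) - \<rho> * ((2 * pi - 1.12) * (\<delta> + 2 * (\<delta> / 500))\<^sup>2)
      = \<rho> * \<delta>\<^sup>2 * (1.12 * (251 / 250)\<^sup>2 - pi * (4 / 125))"
    by (simp add: power2_eq_square field_simps)
  \<comment> \<open>The crude \<open>pi < 4\<close> just suffices: the right-hand side then exceeds
    1.0009.\<close>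
  moreover have "1 \<le> 1.12 * (251 / 250)\<^sup>2 - pi * (4 / 125)"
    using pi_less_4 by (simp add: power2_eq_square)
  then have "\<rho> * \<delta>\<^sup>2 * 1 \<le> \<rho> * \<delta>\<^sup>2 * (1.12 * (251 / 250)\<^sup>2 - pi * (4 / 125))"
    using assms by (intro mult_left_mono) auto
  ultimately show ?thesis by simp
qed

lemma EIR_matern_I_ge:
  fixes \<rho> \<delta> :: real
  assumes \<alpha>: "2 < \<alpha>" and \<rho>: "0 < \<rho>" and \<delta>: "0 < \<delta>" and r0: "r0 \<le> \<delta>"
    and ppp: "stationary_ppp \<rho> P \<Psi>" and fad: "fading H h"
  shows "ennreal (2 powr (- \<alpha>) * (\<alpha> - 2) / (500000 * pi) * exp (\<rho> * \<delta>\<^sup>2))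
    \<le> EIR P (\<lambda>\<omega>. matern_I \<delta> (\<Psi> \<omega>)) \<delta> H h (power_path_loss \<alpha> r0)"
proof -
  define t where "t = \<delta> / 500"
  have t: "0 < t" "8 * t \<le> \<delta>" using \<delta> by (auto simp: t_def)
  obtain n where n: "0 < n" "1 / real n < t"
    using reals_Archimedean[OF t(1)] by (metis inverse_eq_divide zero_less_Suc)
  define \<kappa> where "\<kappa> = intensity P (\<lambda>\<omega>. matern_I \<delta> (\<Psi> \<omega>))"
  define L where "L = \<rho> * exp (- (\<rho> * (pi * (\<delta> - 2 * t)\<^sup>2)))"
  define p where "p = exp (- (\<rho> * ((2 * pi - 1.12) * (\<delta> + 2 * t)\<^sup>2)))"
  define N where "N = (2 * \<delta>) powr (- \<alpha>) * (\<rho>\<^sup>2 * t\<^sup>2 * p)"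
  define J where "J = \<delta> powr (2 - \<alpha>) / (\<alpha> - 2)"
  have pos: "0 < L" "0 \<le> N" "0 < J"
    using \<rho> \<delta> \<alpha> by (auto simp: L_def N_def J_def p_def)
  have "\<kappa> \<le> ennreal (\<rho> * exp (- (\<rho> * (pi * (\<delta> - 2 / real n)\<^sup>2))))"
    unfolding \<kappa>_def using n t by (intro intensity_matern_I_le[OF ppp \<rho>]) auto
  also have "\<dots> \<le> ennreal L"
    unfolding L_def using n t \<rho> by (intro ennreal_leI) (auto intro!: mult_left_mono power_mono)
  finally have \<kappa>_le: "\<kappa> \<le> ennreal L" .
  have palm: "ennreal N / \<kappa> \<le> palm_mean_interference P (\<lambda>\<omega>. matern_I \<delta> (\<Psi> \<omega>)) H h (power_path_loss \<alpha> r0)"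
    unfolding \<kappa>_def N_def p_def
    using n t \<alpha> r0 by (intro palm_mean_interference_matern_I_ge[OF ppp fad \<rho>]) auto
  \<comment> \<open>\<open>L\<close> occurs squared because the intensity divides twice, once in the
    Palm normalisation and once in the Poisson reference. This doubles the disk area in the exponent
    and cancels the \<open>2 * pi\<close> of the pair up to the margins.\<close>
  have gain: "exp (\<rho> * \<delta>\<^sup>2) \<le> p * \<rho>\<^sup>2 / L\<^sup>2"
  proof -
    have "L\<^sup>2 = \<rho>\<^sup>2 * exp (- (2 * (\<rho> * (pi * (\<delta> - 2 * t)\<^sup>2))))"
      by (simp add: L_def power_mult_distrib flip: exp_double)
    then have "p * \<rho>\<^sup>2 / L\<^sup>2 = p / exp (- (2 * (\<rho> * (pi * (\<delta> - 2 * t)\<^sup>2))))"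
      using \<rho> by simp
    also have "\<dots> = exp (2 * (\<rho> * (pi * (\<delta> - 2 * t)\<^sup>2)) - \<rho> * ((2 * pi - 1.12) * (\<delta> + 2 * t)\<^sup>2))"
      unfolding p_def exp_diff[symmetric] by (rule arg_cong[where f = exp]) simp
    finally show ?thesis
      using exponent_gain[OF \<rho>, of \<delta>] by (simp add: t_def)
  qed
  \<comment> \<open>All powers of \<open>\<delta>\<close> cancel, which makes the constant depend on
    \<open>\<alpha>\<close> alone; 500000 is 2 * 500^2, from the reference factor 2 and
    \<open>t = \<delta> / 500\<close>.\<close>
  have J: "(2 * \<delta>) powr (- \<alpha>) * t\<^sup>2 / (2 * pi * J) = 2 powr (- \<alpha>) * (\<alpha> - 2) / (500000 * pi)"
  proof -
    have "\<delta> powr (2 - \<alpha>) = \<delta> powr (- \<alpha>) * \<delta>\<^sup>2"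
      using \<delta> powr_add[of \<delta> "- \<alpha>" 2] by (simp add: powr_numeral)
    then show ?thesis
      using \<delta> \<alpha> by (simp add: J_def t_def powr_mult field_simps)
  qed
  have "2 powr (- \<alpha>) * (\<alpha> - 2) / (500000 * pi) * exp (\<rho> * \<delta>\<^sup>2)
      \<le> 2 powr (- \<alpha>) * (\<alpha> - 2) / (500000 * pi) * (p * \<rho>\<^sup>2 / L\<^sup>2)"
    using gain \<alpha> by (intro mult_left_mono) auto
  also have "\<dots> = N / L / (2 * pi * L * J)"
    unfolding J[symmetric] N_def by (simp add: power2_eq_square mult_ac)
  finally have "ennreal (2 powr (- \<alpha>) * (\<alpha> - 2) / (500000 * pi) * exp (\<rho> * \<delta>\<^sup>2))
      \<le> ennreal (N / L / (2 * pi * L * J))"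
    by (rule ennreal_leI)
  also have "\<dots> = ennreal N / ennreal L / (ennreal (2 * pi) * ennreal L * ennreal J)"
    using pos by (simp add: divide_ennreal ennreal_mult[symmetric])
  also have "\<dots> \<le> palm_mean_interference P (\<lambda>\<omega>. matern_I \<delta> (\<Psi> \<omega>)) H h (power_path_loss \<alpha> r0)
      / (ennreal (2 * pi) * \<kappa> * ennreal J)"
    using \<kappa>_le
    by (intro ennreal_divide_mono_antimono order_trans[OF _ palm] mult_mono) auto
  also have "\<dots> = EIR P (\<lambda>\<omega>. matern_I \<delta> (\<Psi> \<omega>)) \<delta> H h (power_path_loss \<alpha> r0)"
    by (simp add: EIR_def ppp_mean_interference_power_path_loss[OF \<alpha> \<delta> r0] \<kappa>_def J_def)
  finally show ?thesis .
qed

theorem theorem1: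
  fixes \<alpha> :: real
  assumes "\<alpha> > 2"
  shows "\<exists>c>0. \<exists>M>0.
    \<forall>(\<rho>::real) (\<delta>::real) (r0::real) (P::'w measure) (\<Psi>::'w \<Rightarrow> (real ^ 2) set)
      (H::'h measure) (h::real ^ 2 \<Rightarrow> 'h \<Rightarrow> real).
      \<rho> > 0 \<and> \<delta> > 0 \<and> 0 \<le> r0 \<and> r0 \<le> \<delta> \<and> \<rho> * \<delta> \<ge> M \<and>
      stationary_ppp \<rho> P \<Psi> \<and> fading H h \<longrightarrow>
      EIR P (\<lambda>\<omega>. matern_I \<delta> (\<Psi> \<omega>)) \<delta> H h (power_path_loss \<alpha> r0)
        \<ge> ennreal (c * exp (\<rho> * \<delta>\<^sup>2))"
proof (intro exI conjI allI impI)
  show "0 < 2 powr (- \<alpha>) * (\<alpha> - 2) / (500000 * pi)"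
    using assms by simp
  show "(0::real) < 1" by simp
qed (use assms in \<open>elim conjE, intro EIR_matern_I_ge\<close>)

end
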